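(* Let $\rho>0$, $\sigma>0$, and let $f,g:\mathbb{R}^n\to\mathbb{R}$ be such that $g$ is $\rho$-weakly convex, $x\mapsto f(x)-\frac{\rho}{2}\|x\|_2^2$ is convex, and $\nabla f$ is Fréchet differentiable and Lipschitz with constant $\sigma$, i.e. $\|\nabla f(x)-\nabla f(y)\|_2\le\sigma\|x-y\|_2$ for all $x,y\in\mathbb{R}^n$. Assume also that the set of minimizers of $h=f+g$ is non-empty. If $0<\alpha\le 1/\sqrt{\sigma\rho}$ and $0<\lambda<1$, then: (a) the sequence produced (from any starting point $z^0\in\mathbb{R}^n$) by $$z^{k+1}=\Bigl((1-\lambda)I+\lambda\,(2J_{\alpha f}-I)(2J_{\alpha g}-I)\Bigr)(z^k)$$ converges to some $z^*$ such that $J_{\alpha g}(z^* )$ minimizes $h$; (b) the sequence produced (from any starting point $z^0\in\mathbb{R}^n$) by $$z^{k+1}=\Bigl((1-\lambda)I+\lambda\,(2J_{\alpha g}-I)(2J_{\alpha f}-I)\Bigr)(z^k)$$ converges to some $z^*$ such that $J_{\alpha f}(z^* )$ minimizes $h$.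
   Context: A function $g:\mathbb{R}^n\to\mathbb{R}$ is $\rho$-weakly convex if $x\mapsto g(x)+\frac{s}{2}\|x\|_2^2$ is convex for $s\ge\rho$. For $\alpha>0$, the proximity operator of a function $q:\mathbb{R}^n\to\mathbb{R}$ is $J_{\alpha q}(x)=\arg\min_z \frac{1}{2\alpha}\|z-x\|_2^2+q(z)$. $I$ is the identity on $\mathbb{R}^n$, and juxtaposition of operators denotes composition. *)

theory Defs
  imports "HOL-Analysis.Analysis"
begin

definition weakly_convex :: "real \<Rightarrow> ('a::euclidean_space \<Rightarrow> real) \<Rightarrow> bool"
  where "weakly_convex \<rho> g \<longleftrightarrow>
    (\<forall>s\<ge>\<rho>. convex_on UNIV (\<lambda>x. g x + s / 2 * (norm x)\<^sup>2))"

text \<open>Being defined by \<^const>\<open>arg_min\<close>, \<open>prox \<alpha> q x\<close> is a minimizer whenever one exists, chosen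
  arbitrarily if there are several, and an unspecified point if there is none.\<close>

definition prox :: "real \<Rightarrow> ('a::euclidean_space \<Rightarrow> real) \<Rightarrow> 'a \<Rightarrow> 'a"
  where "prox \<alpha> q x = (ARG_MIN (\<lambda>z. 1 / (2 * \<alpha>) * (norm (z - x))\<^sup>2 + q z) z. True)"

definition reflected_prox :: "real \<Rightarrow> ('a::euclidean_space \<Rightarrow> real) \<Rightarrow> 'a \<Rightarrow> 'a"
  where "reflected_prox \<alpha> q x = 2 *\<^sub>R prox \<alpha> q x - x"

definition minimizers :: "('a \<Rightarrow> real) \<Rightarrow> 'a set"
  where "minimizers h = {x. is_arg_min h (\<lambda>_. True) x}"

end

theory Submission
  imports Defs
begin

text \<open>Write \<open>a = \<alpha>\<rho>\<close>; the step size bound gives \<open>a \<le> 1\<close> and \<open>a\<cdot>\<alpha>\<sigma> \<le> 1\<close>. Cocoercivity of the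
  gradient of \<open>f - \<rho>/2 \<parallel>\<cdot>\<parallel>\<^sup>2\<close> makes \<open>2J\<^sub>\<alpha>\<^sub>f - I\<close> Lipschitz with constant \<open>(1 - a)/(1 + a)\<close>, while weak
  convexity of \<open>g\<close> makes \<open>2J\<^sub>\<alpha>\<^sub>g - I\<close> Lipschitz with the reciprocal constant. Hence both compositions
  are nonexpansive and the Krasnoselskii--Mann iteration converges to a fixed point. Fixed
  points correspond to minimizers through \<open>z = x - \<alpha>\<nabla>f(x)\<close>. The case \<open>a = 1\<close>, where \<open>J\<^sub>\<alpha>\<^sub>g\<close> need not
  be defined everywhere, is covered because then \<open>2J\<^sub>\<alpha>\<^sub>f - I\<close> is constant.\<close>

section \<open>Krasnoselskii--Mann iteration of nonexpansive maps\<close>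

lemma norm_affine_sq:
  fixes a b :: "'a::real_inner"
  shows "(norm ((1 - t) *\<^sub>R a + t *\<^sub>R b))\<^sup>2
         = (1 - t) * (norm a)\<^sup>2 + t * (norm b)\<^sup>2 - t * (1 - t) * (norm (a - b))\<^sup>2"
  unfolding power2_norm_eq_inner
  by (simp add: inner_add_left inner_add_right inner_diff_left inner_diff_right inner_commute)
     algebra

text \<open>Distances to any fixed point decrease, and the decrease bounds the residual
  \<open>T (z k) - z k\<close>. By compactness some subsequence converges; its limit is a fixed
  point because the residual vanishes.\<close>

lemma krasnoselskii_mann:
  fixes T :: "'a::euclidean_space \<Rightarrow> 'a"
  assumes nonexp: "\<And>x y. norm (T x - T y) \<le> norm (x - y)"
    and fixp: "T p = p" and lam: "0 < lam" "lam < 1"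
    and z: "\<And>k. z (Suc k) = (1 - lam) *\<^sub>R z k + lam *\<^sub>R T (z k)"
  obtains zs where "z \<longlonglongrightarrow> zs" "T zs = zs"
proof -
  have fejer: "(norm (z (Suc k) - q))\<^sup>2 + lam * (1 - lam) * (norm (T (z k) - z k))\<^sup>2
               \<le> (norm (z k - q))\<^sup>2" if "T q = q" for q k
  proof -
    have "z (Suc k) - q = (1 - lam) *\<^sub>R (z k - q) + lam *\<^sub>R (T (z k) - q)"
      by (simp add: z algebra_simps)
    then have "(norm (z (Suc k) - q))\<^sup>2 = (1 - lam) * (norm (z k - q))\<^sup>2
        + lam * (norm (T (z k) - q))\<^sup>2 - lam * (1 - lam) * (norm (T (z k) - z k))\<^sup>2"
      by (simp add: norm_affine_sq norm_minus_commute)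
    moreover have "(norm (T (z k) - q))\<^sup>2 \<le> (norm (z k - q))\<^sup>2"
      using nonexp[of "z k" q] that by (simp add: power_mono)
    then have "lam * (norm (T (z k) - q))\<^sup>2 \<le> lam * (norm (z k - q))\<^sup>2"
      using lam by simp
    ultimately show ?thesis by (simp add: algebra_simps)
  qed
  have dec: "decseq (\<lambda>k. (norm (z k - q))\<^sup>2)" if "T q = q" for q
  proof (rule decseq_SucI)
    fix k
    have "0 \<le> lam * (1 - lam) * (norm (T (z k) - z k))\<^sup>2" using lam by simp
    then show "(norm (z (Suc k) - q))\<^sup>2 \<le> (norm (z k - q))\<^sup>2"
      using fejer[OF that, of k] by linarith
  qed
  have conv: "\<exists>L. (\<lambda>k. (norm (z k - q))\<^sup>2) \<longlonglongrightarrow> L" if "T q = q" for q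
    by (rule decseq_convergent[OF dec[OF that], of 0]) auto
  obtain L where L: "(\<lambda>k. (norm (z k - p))\<^sup>2) \<longlonglongrightarrow> L" using conv[OF fixp] by blast
  have "(\<lambda>k. (norm (z k - p))\<^sup>2 - (norm (z (Suc k) - p))\<^sup>2) \<longlonglongrightarrow> L - L"
    by (rule tendsto_diff[OF L LIMSEQ_Suc[OF L]])
  then have gap: "(\<lambda>k. (norm (z k - p))\<^sup>2 - (norm (z (Suc k) - p))\<^sup>2) \<longlonglongrightarrow> 0" by simp
  have "(\<lambda>k. lam * (1 - lam) * (norm (T (z k) - z k))\<^sup>2) \<longlonglongrightarrow> 0"
  proof (rule tendsto_sandwich[OF _ _ tendsto_const gap])
    show "\<forall>\<^sub>F k in sequentially. 0 \<le> lam * (1 - lam) * (norm (T (z k) - z k))\<^sup>2"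
      using lam by simp
    show "\<forall>\<^sub>F k in sequentially. lam * (1 - lam) * (norm (T (z k) - z k))\<^sup>2
            \<le> (norm (z k - p))\<^sup>2 - (norm (z (Suc k) - p))\<^sup>2"
      using fejer[OF fixp] by (intro always_eventually allI) (simp add: algebra_simps)
  qed
  then have "(\<lambda>k. (norm (T (z k) - z k))\<^sup>2) \<longlonglongrightarrow> 0"
    using tendsto_mult_left_iff[of "lam * (1 - lam)" _ 0] lam by force
  then have "(\<lambda>k. sqrt ((norm (T (z k) - z k))\<^sup>2)) \<longlonglongrightarrow> sqrt 0"
    by (rule tendsto_real_sqrt)
  then have "(\<lambda>k. norm (T (z k) - z k)) \<longlonglongrightarrow> 0" by simp
  then have res: "(\<lambda>k. T (z k) - z k) \<longlonglongrightarrow> 0" by (rule tendsto_norm_zero_cancel)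
  have "norm (z k - p) \<le> norm (z 0 - p)" for k
    using decseqD[OF dec[OF fixp], of 0 k] by (simp add: power2_le_iff_abs_le)
  then have "bounded (range z)"
    by (intro boundedI[of _ "norm (z 0 - p) + norm p"]) (smt (verit) norm_triangle_sub rangeE)
  then obtain zs r where r: "strict_mono r" and lim: "(z \<circ> r) \<longlonglongrightarrow> zs"
    using bounded_imp_convergent_subsequence by blast
  have "(\<lambda>k. z (r k) - zs) \<longlonglongrightarrow> 0"
    using lim by (simp add: o_def LIM_zero)
  then have "(\<lambda>k. T (z (r k)) - T zs) \<longlonglongrightarrow> 0"
    by (rule Lim_null_comparison[OF always_eventually, rotated, OF tendsto_norm_zero])
       (use nonexp in auto)
  then have "(\<lambda>k. T (z (r k))) \<longlonglongrightarrow> T zs" by (rule LIM_zero_cancel)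
  then have "(\<lambda>k. T (z (r k)) - z (r k)) \<longlonglongrightarrow> T zs - zs"
    using lim by (intro tendsto_diff) (auto simp: o_def)
  moreover have "(\<lambda>k. T (z (r k)) - z (r k)) \<longlonglongrightarrow> 0"
    using LIMSEQ_subseq_LIMSEQ[OF res r] by (simp add: o_def)
  ultimately have Tzs: "T zs = zs" using LIMSEQ_unique by force
  \<comment> \<open>Monotonicity of distances now applies to \<open>zs\<close> itself, so
    convergence along the subsequence forces convergence of the whole sequence.\<close>
  obtain M where M: "(\<lambda>k. (norm (z k - zs))\<^sup>2) \<longlonglongrightarrow> M" using conv[OF Tzs] by blast
  have "(\<lambda>k. (norm (z (r k) - zs))\<^sup>2) \<longlonglongrightarrow> 0"
    using tendsto_power[OF tendsto_norm[OF \<open>(\<lambda>k. z (r k) - zs) \<longlonglongrightarrow> 0\<close>], of 2] by simp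
  moreover have "(\<lambda>k. (norm (z (r k) - zs))\<^sup>2) \<longlonglongrightarrow> M"
    using LIMSEQ_subseq_LIMSEQ[OF M r] by (simp add: o_def)
  ultimately have "M = 0" using LIMSEQ_unique by blast
  then have "(\<lambda>k. sqrt ((norm (z k - zs))\<^sup>2)) \<longlonglongrightarrow> sqrt 0"
    using M by (intro tendsto_real_sqrt) simp
  then have "(\<lambda>k. norm (z k - zs)) \<longlonglongrightarrow> 0" by simp
  then have "z \<longlonglongrightarrow> zs" by (rule LIM_zero_cancel[OF tendsto_norm_zero_cancel])
  then show ?thesis using Tzs that by blast
qed

section \<open>Weak subgradients\<close>

text \<open>For \<open>r > 0\<close> this is the subgradient notion of \<open>r\<close>-weakly convex functions; a negative \<open>r\<close> encodes
  strong convexity, so that \<open>f\<close> and \<open>g\<close> are treated alike.\<close>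

definition weak_subgradient :: "real \<Rightarrow> ('a::real_inner \<Rightarrow> real) \<Rightarrow> 'a \<Rightarrow> 'a \<Rightarrow> bool"
  where "weak_subgradient r q u v \<longleftrightarrow>
    (\<forall>y. q u + v \<bullet> (y - u) - r / 2 * (norm (y - u))\<^sup>2 \<le> q y)"

lemma weak_subgradientD:
  "weak_subgradient r q u v \<Longrightarrow> q u + v \<bullet> (y - u) - r / 2 * (norm (y - u))\<^sup>2 \<le> q y"
  by (simp add: weak_subgradient_def)

lemma weak_subgradient_mono:
  assumes "weak_subgradient r q u v" "r \<le> s"
  shows "weak_subgradient s q u v"
  unfolding weak_subgradient_def
proof
  fix y
  have "r / 2 * (norm (y - u))\<^sup>2 \<le> s / 2 * (norm (y - u))\<^sup>2"
    using assms(2) by (intro mult_right_mono) auto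
  then show "q u + v \<bullet> (y - u) - s / 2 * (norm (y - u))\<^sup>2 \<le> q y"
    using weak_subgradientD[OF assms(1), of y] by linarith
qed

text \<open>The function values cancel when each inequality is taken at the other base point and the
  two are added.\<close>

lemma weak_subgradient_monotone:
  assumes "weak_subgradient r q u v" "weak_subgradient r q u' v'"
  shows "- r * (norm (u - u'))\<^sup>2 \<le> (v - v') \<bullet> (u - u')"
  using weak_subgradientD[OF assms(1), of u'] weak_subgradientD[OF assms(2), of u]
  by (simp add: norm_minus_commute[of u' u] inner_diff_left inner_diff_right)

text \<open>Along a segment ending at \<open>u\<close> a quadratic error is of second order, so convexity improves
  any constant \<open>c\<close> to \<open>r\<close>.\<close>

lemma weak_subgradient_sharpen:
  assumes conv: "convex_on UNIV (\<lambda>x. q x + r / 2 * (norm x)\<^sup>2)"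
    and sub: "weak_subgradient c q u v"
  shows "weak_subgradient r q u v"
  unfolding weak_subgradient_def
proof
  fix y
  \<comment> \<open>\<open>E\<close> is the violation of the claimed inequality at \<open>y\<close>.
    Bounding \<open>q w\<close> on the segment from both sides and dividing by \<open>t\<close>
    leaves only the error \<open>t * K\<close>.\<close>
  define E where "E = q u + v \<bullet> (y - u) - r / 2 * (norm (y - u))\<^sup>2 - q y"
  define K where "K = (c / 2 - r / 2) * (norm (y - u))\<^sup>2"
  have E: "E \<le> t * K" if t: "0 < t" "t \<le> 1" for t
  proof -
    define w where "w = (1 - t) *\<^sub>R u + t *\<^sub>R y"
    have wu: "w - u = t *\<^sub>R (y - u)" by (simp add: w_def algebra_simps)
    have "q w + r / 2 * (norm w)\<^sup>2
          \<le> (1 - t) * (q u + r / 2 * (norm u)\<^sup>2) + t * (q y + r / 2 * (norm y)\<^sup>2)"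
      unfolding w_def using convex_onD[OF conv, of t u y] t by simp
    moreover have norm_w: "(norm w)\<^sup>2
          = (1 - t) * (norm u)\<^sup>2 + t * (norm y)\<^sup>2 - t * (1 - t) * (norm (y - u))\<^sup>2"
      unfolding w_def norm_affine_sq by (simp add: norm_minus_commute)
    have "c * (norm w)\<^sup>2 = (1 - t) * (c * (norm u)\<^sup>2) + t * (c * (norm y)\<^sup>2)
          - c * (t * (1 - t) * (norm (y - u))\<^sup>2)" for c
      unfolding norm_w by (simp add: algebra_simps)
    note this[of "r / 2"]
    ultimately have "q w \<le> (1 - t) * q u + t * q y + r / 2 * (t * (1 - t) * (norm (y - u))\<^sup>2)"
      unfolding distrib_left by linarith
    moreover have "q u + t * (v \<bullet> (y - u)) - c / 2 * (t\<^sup>2 * (norm (y - u))\<^sup>2) \<le> q w"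
      using weak_subgradientD[OF sub, of w] by (simp add: wu power_mult_distrib)
    ultimately have "t * E \<le> t * (t * K)"
      unfolding E_def K_def by (simp add: algebra_simps power2_eq_square)
    then show ?thesis using t by simp
  qed
  have "E \<le> 0"
  proof (rule tendsto_lowerbound)
    show "((\<lambda>t. t * K) \<longlongrightarrow> 0) (at_right 0)" by (auto intro!: tendsto_eq_intros)
    show "\<forall>\<^sub>F t in at_right 0. E \<le> t * K"
      using E by (intro eventually_at_rightI[of 0 1]) auto
  qed simp
  then show "q u + v \<bullet> (y - u) - r / 2 * (norm (y - u))\<^sup>2 \<le> q y" by (simp add: E_def)
qed

section \<open>Proximity operators as resolvents of weak subgradients\<close>

text \<open>Expanding \<open>(norm (y - x))\<^sup>2\<close> around \<open>u\<close> turns minimality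
  into the subgradient inequality, point by point.\<close>

lemma is_arg_min_prox_iff:
  fixes q :: "'a::euclidean_space \<Rightarrow> real"
  assumes "0 < \<alpha>"
  shows "is_arg_min (\<lambda>z. 1 / (2 * \<alpha>) * (norm (z - x))\<^sup>2 + q z) (\<lambda>_. True) u
         \<longleftrightarrow> weak_subgradient (1 / \<alpha>) q u ((1 / \<alpha>) *\<^sub>R (x - u))"
proof -
  have eq: "1 / (2 * \<alpha>) * (norm (y - x))\<^sup>2
        = 1 / (2 * \<alpha>) * (norm (u - x))\<^sup>2 - ((1 / \<alpha>) *\<^sub>R (x - u)) \<bullet> (y - u)
          + 1 / \<alpha> / 2 * (norm (y - u))\<^sup>2" for y
    unfolding power2_norm_eq_inner using assms
    by (simp add: inner_diff_left inner_diff_right inner_commute field_simps)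
  have "1 / (2 * \<alpha>) * (norm (u - x))\<^sup>2 + q u \<le> 1 / (2 * \<alpha>) * (norm (y - x))\<^sup>2 + q y
        \<longleftrightarrow> q u + ((1 / \<alpha>) *\<^sub>R (x - u)) \<bullet> (y - u) - 1 / \<alpha> / 2 * (norm (y - u))\<^sup>2 \<le> q y" for y
    using eq[of y] by (intro iffI; linarith)
  then show ?thesis
    unfolding is_arg_min_linorder weak_subgradient_def by blast
qed

text \<open>The point \<open>u\<close> only witnesses that a minimizer exists, so that the choice in
  \<open>prox\<close> is a genuine one. The chosen point may differ from \<open>u\<close> if
  \<open>\<alpha> * r = 1\<close>.\<close>

lemma prox_weak_subgradient:
  fixes q :: "'a::euclidean_space \<Rightarrow> real"
  assumes "0 < \<alpha>" and "\<alpha> * r \<le> 1" and "convex_on UNIV (\<lambda>x. q x + r / 2 * (norm x)\<^sup>2)"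
    and "weak_subgradient r q u ((1 / \<alpha>) *\<^sub>R (x - u))"
  shows "weak_subgradient r q (prox \<alpha> q x) ((1 / \<alpha>) *\<^sub>R (x - prox \<alpha> q x))"
proof -
  have "r \<le> 1 / \<alpha>" using assms(1,2) by (simp add: field_simps)
  then have "is_arg_min (\<lambda>z. 1 / (2 * \<alpha>) * (norm (z - x))\<^sup>2 + q z) (\<lambda>_. True) u"
    using assms(1,4) is_arg_min_prox_iff weak_subgradient_mono by blast
  then have "is_arg_min (\<lambda>z. 1 / (2 * \<alpha>) * (norm (z - x))\<^sup>2 + q z) (\<lambda>_. True) (prox \<alpha> q x)"
    unfolding prox_def arg_min_def by (rule someI)
  then show ?thesis
    using assms(1,3) is_arg_min_prox_iff weak_subgradient_sharpen by blast
qed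

text \<open>The two subgradients differ by \<open>- (1 / \<alpha>) *\<^sub>R (u - u')\<close>, which
  is too negative for weak monotonicity with \<open>r < 1 / \<alpha>\<close> unless
  \<open>u = u'\<close>.\<close>

lemma weak_subgradient_resolvent_unique:
  assumes "0 < \<alpha>" "\<alpha> * r < 1"
    and "weak_subgradient r q u ((1 / \<alpha>) *\<^sub>R (x - u))"
    and "weak_subgradient r q u' ((1 / \<alpha>) *\<^sub>R (x - u'))"
  shows "u = u'"
proof -
  have "(1 / \<alpha>) *\<^sub>R (x - u) - (1 / \<alpha>) *\<^sub>R (x - u') = - (1 / \<alpha>) *\<^sub>R (u - u')"
    by (simp add: algebra_simps)
  then have "- r * (norm (u - u'))\<^sup>2 \<le> - (1 / \<alpha>) * (norm (u - u'))\<^sup>2"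
    using weak_subgradient_monotone[OF assms(3,4)] by (simp add: power2_norm_eq_inner)
  then have "(1 / \<alpha> - r) * (norm (u - u'))\<^sup>2 \<le> 0" by (simp add: algebra_simps)
  moreover have "1 / \<alpha> - r > 0" using assms(1,2) by (simp add: field_simps)
  ultimately have "(norm (u - u'))\<^sup>2 \<le> 0" by (simp add: mult_le_0_iff)
  then show ?thesis by simp
qed

text \<open>One subgradient of \<open>q\<close> suffices to make the proximal objective coercive,
  with quadratic growth \<mu> = 1/\<alpha> - r; a minimizer on a large ball is then global.\<close>

lemma weak_subgradient_resolvent_exists:
  fixes q :: "'a::euclidean_space \<Rightarrow> real"
  assumes \<alpha>: "0 < \<alpha>" "\<alpha> * r < 1"
    and conv: "convex_on UNIV (\<lambda>x. q x + r / 2 * (norm x)\<^sup>2)"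
    and sub: "weak_subgradient r q x\<^sub>0 v"
  shows "\<exists>u. weak_subgradient r q u ((1 / \<alpha>) *\<^sub>R (x - u))"
proof -
  define \<phi> where "\<phi> = (\<lambda>z. 1 / (2 * \<alpha>) * (norm (z - x))\<^sup>2 + q z)"
  define \<mu> where "\<mu> = 1 / \<alpha> - r"
  \<comment> \<open>\<open>b\<close> is the slope at \<open>x\<^sub>0\<close> of the quadratic lower
    model of \<open>\<phi>\<close>; beyond radius \<open>R\<close> its linear term is dominated by
    the quadratic one.\<close>
  define b where "b = v + (1 / \<alpha>) *\<^sub>R (x\<^sub>0 - x)"
  define R where "R = 2 * norm b / \<mu>"
  have \<mu>: "\<mu> > 0" using \<alpha> by (simp add: \<mu>_def field_simps)
  have "continuous_on UNIV (\<lambda>x. (q x + r / 2 * (norm x)\<^sup>2) - r / 2 * (norm x)\<^sup>2)"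
    by (intro continuous_on_diff[OF convex_on_continuous[OF open_UNIV conv]] continuous_intros)
  then have "continuous_on UNIV q" by simp
  then have "continuous_on (cball x\<^sub>0 R) \<phi>"
    unfolding \<phi>_def by (intro continuous_intros) (auto intro: continuous_on_subset)
  moreover have "x\<^sub>0 \<in> cball x\<^sub>0 R" using \<mu> by (simp add: R_def)
  ultimately obtain u where u: "\<And>y. y \<in> cball x\<^sub>0 R \<Longrightarrow> \<phi> u \<le> \<phi> y"
    using continuous_attains_inf[of "cball x\<^sub>0 R" \<phi>] by (metis compact_cball empty_iff)
  have far: "\<phi> x\<^sub>0 \<le> \<phi> y" if "y \<notin> cball x\<^sub>0 R" for y
  proof -
    define w where "w = y - x\<^sub>0"
    have "R < norm w" using that by (simp add: w_def dist_norm norm_minus_commute)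
    then have "norm b \<le> \<mu> / 2 * norm w" using \<mu> by (simp add: R_def field_simps)
    then have "norm b * norm w \<le> \<mu> / 2 * norm w * norm w" by (intro mult_right_mono) auto
    moreover have "- (norm b * norm w) \<le> b \<bullet> w"
      using Cauchy_Schwarz_ineq2[of b w] by linarith
    ultimately have "0 \<le> b \<bullet> w + \<mu> / 2 * (norm w)\<^sup>2" by (simp add: power2_eq_square)
    also have "\<dots> = v \<bullet> w - r / 2 * (norm w)\<^sup>2
        + 1 / (2 * \<alpha>) * ((norm (y - x))\<^sup>2 - (norm (x\<^sub>0 - x))\<^sup>2)"
      unfolding b_def \<mu>_def w_def power2_norm_eq_inner using \<alpha>(1)
      by (simp add: inner_add_left inner_add_right inner_diff_left inner_diff_right inner_commute
          field_simps)
    finally show ?thesis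
      using weak_subgradientD[OF sub, of y] unfolding \<phi>_def w_def by (simp add: algebra_simps)
  qed
  have "\<phi> u \<le> \<phi> y" for y
    using u[of y] u[OF \<open>x\<^sub>0 \<in> cball x\<^sub>0 R\<close>] far[of y] by (cases "y \<in> cball x\<^sub>0 R") auto
  then have "is_arg_min \<phi> (\<lambda>_. True) u" by (simp add: is_arg_min_linorder)
  then show ?thesis
    unfolding \<phi>_def is_arg_min_prox_iff[OF \<alpha>(1)] using weak_subgradient_sharpen[OF conv] by blast
qed

section \<open>Smoothness and cocoercivity of the gradient\<close>

text \<open>Along the segment, \<open>f\<close> minus its upper model has nonpositive derivative, by
  Cauchy--Schwarz and the Lipschitz bound.\<close>

lemma descent_lemma:
  fixes f :: "'a::real_inner \<Rightarrow> real"
  assumes deriv: "\<And>x. GDERIV f x :> G x"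
    and lip: "\<And>x y. norm (G x - G y) \<le> \<sigma> * norm (x - y)"
  shows "f y \<le> f x + G x \<bullet> (y - x) + \<sigma> / 2 * (norm (y - x))\<^sup>2"
proof -
  define d where "d = y - x"
  define \<phi> where "\<phi> = (\<lambda>t. f (x + t *\<^sub>R d) - t * (G x \<bullet> d) - \<sigma> / 2 * t\<^sup>2 * (norm d)\<^sup>2)"
  have "\<phi> 1 \<le> \<phi> 0"
  proof (rule DERIV_nonpos_imp_nonincreasing[of 0 1 \<phi>])
    fix t :: real
    assume t: "0 \<le> t" "t \<le> 1"
    have "((\<lambda>t. f (x + t *\<^sub>R d)) has_derivative (\<lambda>h. (h *\<^sub>R d) \<bullet> G (x + t *\<^sub>R d))) (at t)"
      by (rule has_derivative_compose[of "\<lambda>t. x + t *\<^sub>R d" "\<lambda>h. h *\<^sub>R d"])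
         (use deriv in \<open>auto simp: gderiv_def intro!: derivative_eq_intros\<close>)
    then have *: "((\<lambda>t. f (x + t *\<^sub>R d)) has_field_derivative G (x + t *\<^sub>R d) \<bullet> d) (at t)"
      unfolding has_field_derivative_def
      by (rule has_derivative_eq_rhs) (simp add: fun_eq_iff inner_commute)
    have "(\<phi> has_field_derivative (G (x + t *\<^sub>R d) - G x) \<bullet> d - \<sigma> * t * (norm d)\<^sup>2) (at t)"
      unfolding \<phi>_def by (rule derivative_eq_intros * refl)+ (simp add: inner_diff_left)
    moreover have "(G (x + t *\<^sub>R d) - G x) \<bullet> d - \<sigma> * t * (norm d)\<^sup>2 \<le> 0"
    proof -
      have "(G (x + t *\<^sub>R d) - G x) \<bullet> d \<le> norm (G (x + t *\<^sub>R d) - G x) * norm d"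
        by (rule norm_cauchy_schwarz)
      also have "\<dots> \<le> \<sigma> * (t * norm d) * norm d"
        using lip[of "x + t *\<^sub>R d" x] t by (intro mult_right_mono) auto
      finally show ?thesis by (simp add: power2_eq_square algebra_simps)
    qed
    ultimately show "\<exists>D. (\<phi> has_field_derivative D) (at t) \<and> D \<le> 0" by blast
  qed simp
  then show ?thesis by (simp add: \<phi>_def d_def)
qed

text \<open>Testing with a small multiple of \<open>m\<close>, the linear side would beat the
  quadratic one.\<close>

lemma inner_le_quadratic_imp_zero:
  fixes m :: "'a::real_inner"
  assumes "\<And>d. m \<bullet> d \<le> c * (norm d)\<^sup>2"
  shows "m = 0"
proof (rule ccontr)
  assume "m \<noteq> 0"
  define t where "t = 1 / (\<bar>c\<bar> + 1)"
  have t: "t > 0" "c * t < 1" by (auto simp: t_def field_simps)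
  have "t * (norm m)\<^sup>2 \<le> c * t * t * (norm m)\<^sup>2"
    using assms[of "t *\<^sub>R m"] by (simp add: power_mult_distrib power2_norm_eq_inner power2_eq_square[of t])
  then have "1 \<le> c * t" using \<open>m \<noteq> 0\<close> t by simp
  then show False using t by simp
qed

text \<open>The Baillon--Haddad inequality for \<open>f - \<rho>/2 \<parallel>\<cdot>\<parallel>\<^sup>2\<close>. Comparing the lower model at \<open>x\<close> with the upper
  model at \<open>y\<close> at the point \<open>y + \<tau> m\<close>, and symmetrically, leaves one inequality in the free \<open>\<tau>\<close>.\<close>

lemma gradient_cocoercive:
  fixes f :: "'a::real_inner \<Rightarrow> real"
  assumes lower: "\<And>x. weak_subgradient (- \<rho>) f x (G x)"
    and upper: "\<And>x y. f y \<le> f x + G x \<bullet> (y - x) + \<sigma> / 2 * (norm (y - x))\<^sup>2"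
  shows "0 \<le> (G x - G y - \<rho> *\<^sub>R (x - y)) \<bullet> (\<sigma> *\<^sub>R (x - y) - (G x - G y))"
proof -
  define m where "m = G x - G y - \<rho> *\<^sub>R (x - y)"
  have model: "G x \<bullet> (y - x) + \<rho> / 2 * (norm (y - x))\<^sup>2 + (G x - G y - \<rho> *\<^sub>R (x - y)) \<bullet> e
        - (\<sigma> - \<rho>) / 2 * (norm e)\<^sup>2 \<le> f y - f x" for x y e
  proof -
    have "f x + G x \<bullet> (y - x + e) + \<rho> / 2 * (norm (y - x + e))\<^sup>2
          \<le> f y + G y \<bullet> e + \<sigma> / 2 * (norm e)\<^sup>2"
      using weak_subgradientD[OF lower, of x "y + e"] upper[of "y + e" y]
      by (simp add: algebra_simps)
    then show ?thesis
      unfolding power2_norm_eq_inner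
      by (simp add: inner_add_left inner_add_right inner_diff_left inner_diff_right inner_commute
          algebra_simps diff_divide_distrib)
  qed
  have key: "(2 * t - (\<sigma> - \<rho>) * t\<^sup>2) * (norm m)\<^sup>2 \<le> m \<bullet> (x - y)" for t
  proof -
    have "G y - G x - \<rho> *\<^sub>R (y - x) = - m" by (simp add: m_def algebra_simps)
    then have "G y \<bullet> (x - y) + \<rho> / 2 * (norm (x - y))\<^sup>2 + t * (norm m)\<^sup>2
        - (\<sigma> - \<rho>) / 2 * (t\<^sup>2 * (norm m)\<^sup>2) \<le> f x - f y"
      using model[of y x "- t *\<^sub>R m"] by (simp add: power_mult_distrib power2_norm_eq_inner)
    moreover have "G x \<bullet> (y - x) + \<rho> / 2 * (norm (x - y))\<^sup>2 + t * (norm m)\<^sup>2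
        - (\<sigma> - \<rho>) / 2 * (t\<^sup>2 * (norm m)\<^sup>2) \<le> f y - f x"
      using model[of x y "t *\<^sub>R m", folded m_def]
      by (simp add: power_mult_distrib power2_norm_eq_inner norm_minus_commute)
    moreover have "m \<bullet> (x - y) = - (G x \<bullet> (y - x)) - G y \<bullet> (x - y) - \<rho> * (norm (x - y))\<^sup>2"
      by (simp add: m_def power2_norm_eq_inner inner_diff_left inner_diff_right algebra_simps)
    moreover have "(2 * t - (\<sigma> - \<rho>) * t\<^sup>2) * (norm m)\<^sup>2
        = 2 * (t * (norm m)\<^sup>2) - 2 * ((\<sigma> - \<rho>) / 2 * (t\<^sup>2 * (norm m)\<^sup>2))"
      by (simp add: field_simps)
    ultimately show ?thesis by linarith
  qed
  \<comment> \<open>If \<sigma> > \<rho>, the choice \<open>t = 1 / (\<sigma> - \<rho>)\<close>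
    maximizes the left side of \<open>key\<close>; otherwise that side is unbounded in
    \<open>t\<close> unless \<open>m = 0\<close>.\<close>
  have "(norm m)\<^sup>2 \<le> (\<sigma> - \<rho>) * (m \<bullet> (x - y))"
  proof (cases "\<sigma> - \<rho> > 0")
    case True
    then have "(\<sigma> - \<rho>) * (1 / (\<sigma> - \<rho>))\<^sup>2 = 1 / (\<sigma> - \<rho>)" by (simp add: power2_eq_square)
    then have "1 / (\<sigma> - \<rho>) * (norm m)\<^sup>2 \<le> m \<bullet> (x - y)"
      using key[of "1 / (\<sigma> - \<rho>)"] by simp
    then show ?thesis using True by (simp add: divide_le_eq mult.commute)
  next
    case False
    have "m = 0"
    proof (rule ccontr)
      assume m: "m \<noteq> 0"
      define t where "t = (\<bar>m \<bullet> (x - y)\<bar> + 1) / (norm m)\<^sup>2"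
      have t: "t * (norm m)\<^sup>2 = \<bar>m \<bullet> (x - y)\<bar> + 1" using m by (simp add: t_def)
      have "(\<sigma> - \<rho>) * t\<^sup>2 \<le> 0" using False by (simp add: mult_nonpos_nonneg)
      then have "2 * t * (norm m)\<^sup>2 \<le> (2 * t - (\<sigma> - \<rho>) * t\<^sup>2) * (norm m)\<^sup>2"
        by (intro mult_right_mono) auto
      then show False using key[of t] t by simp
    qed
    then show ?thesis by simp
  qed
  moreover have "\<sigma> *\<^sub>R (x - y) - (G x - G y) = (\<sigma> - \<rho>) *\<^sub>R (x - y) - m"
    by (simp add: m_def algebra_simps)
  ultimately show ?thesis
    unfolding m_def[symmetric] by (simp add: inner_diff_right power2_norm_eq_inner)
qed

section \<open>Optimality conditions for the two summands\<close>

locale douglas_rachford =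
  fixes f g :: "'a::euclidean_space \<Rightarrow> real" and G :: "'a \<Rightarrow> 'a" and \<rho> \<sigma> \<alpha> :: real
  assumes \<rho>: "\<rho> > 0" and \<sigma>: "\<sigma> > 0"
    and g_convex: "convex_on UNIV (\<lambda>x. g x + \<rho> / 2 * (norm x)\<^sup>2)"
    and f_convex: "convex_on UNIV (\<lambda>x. f x - \<rho> / 2 * (norm x)\<^sup>2)"
    and gderiv: "\<And>x. GDERIV f x :> G x"
    and lipschitz: "\<And>x y. norm (G x - G y) \<le> \<sigma> * norm (x - y)"
    and minimizer: "minimizers (\<lambda>x. f x + g x) \<noteq> {}"
    and \<alpha>: "0 < \<alpha>" "\<alpha> \<le> 1 / sqrt (\<sigma> * \<rho>)"
begin

lemma f_convex': "convex_on UNIV (\<lambda>x. f x + (- \<rho>) / 2 * (norm x)\<^sup>2)"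
  using f_convex by simp

lemma f_upper: "f y \<le> f x + G x \<bullet> (y - x) + \<sigma> / 2 * (norm (y - x))\<^sup>2"
  using gderiv lipschitz by (rule descent_lemma)

text \<open>The descent lemma for \<open>- f\<close> gives a lower model with the crude constant
  \<sigma>, which strong convexity sharpens to -\<rho>.\<close>

lemma f_subgradient: "weak_subgradient (- \<rho>) f x (G x)"
proof (rule weak_subgradient_sharpen[OF f_convex'])
  have "GDERIV (\<lambda>x. - f x) x :> - G x" for x
    using gderiv by (rule GDERIV_minus)
  moreover have "norm (- G x - - G y) \<le> \<sigma> * norm (x - y)" for x y
    using lipschitz[of x y] by (simp add: norm_minus_commute)
  ultimately have "- f y \<le> - f x + - G x \<bullet> (y - x) + \<sigma> / 2 * (norm (y - x))\<^sup>2" for y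
    by (rule descent_lemma)
  then show "weak_subgradient \<sigma> f x (G x)"
    unfolding weak_subgradient_def by (simp add: algebra_simps)
qed

text \<open>Comparing the lower model of slope \<open>v\<close> with the upper model of slope
  \<open>G x\<close> bounds a linear function by a quadratic one.\<close>

lemma f_subgradient_iff: "weak_subgradient (- \<rho>) f x v \<longleftrightarrow> v = G x"
proof
  assume v: "weak_subgradient (- \<rho>) f x v"
  have "(v - G x) \<bullet> d \<le> ((\<sigma> - \<rho>) / 2) * (norm d)\<^sup>2" for d
    using weak_subgradientD[OF v, of "x + d"] f_upper[of "x + d" x]
    by (simp add: inner_diff_left algebra_simps)
  then show "v = G x" using inner_le_quadratic_imp_zero by fastforce
qed (simp add: f_subgradient)

lemma a_le_1: "\<alpha> * \<rho> \<le> 1" and a_mult_le_1: "(\<alpha> * \<rho>) * (\<alpha> * \<sigma>) \<le> 1"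
proof -
  have "\<alpha> * sqrt (\<sigma> * \<rho>) \<le> 1" using \<alpha> \<rho> \<sigma> by (simp add: field_simps)
  then have "(\<alpha> * sqrt (\<sigma> * \<rho>))\<^sup>2 \<le> 1" using \<alpha> \<rho> \<sigma> by (simp add: power_le_one)
  then show *: "(\<alpha> * \<rho>) * (\<alpha> * \<sigma>) \<le> 1"
    using \<rho> \<sigma> by (simp add: power_mult_distrib power2_eq_square algebra_simps)
  \<comment> \<open>The lower and upper models of \<open>f\<close> at 0, compared at a unit vector,
    give \<rho> \<le> \<sigma>.\<close>
  obtain d :: 'a where d: "norm d = 1" using norm_Basis nonempty_Basis by blast
  have "\<rho> \<le> \<sigma>"
    using weak_subgradientD[OF f_subgradient, of 0 d] f_upper[of d 0] d by simp
  then have "(\<alpha> * \<rho>)\<^sup>2 \<le> (\<alpha> * \<rho>) * (\<alpha> * \<sigma>)"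
    using \<alpha> \<rho> by (simp add: power2_eq_square)
  then have "(\<alpha> * \<rho>)\<^sup>2 \<le> 1\<^sup>2" using * by simp
  then show "\<alpha> * \<rho> \<le> 1" by (rule power2_le_imp_le) simp
qed

text \<open>Strong convexity gives the proximal problem exactly one solution, so
  \<open>prox \<alpha> f\<close> is a true inverse of \<open>u + \<alpha> *\<^sub>R G u\<close>,
  free of arbitrary choices.\<close>

lemma prox_f_eq_iff: "prox \<alpha> f x = u \<longleftrightarrow> x = u + \<alpha> *\<^sub>R G u"
proof -
  have neg: "\<alpha> * (- \<rho>) < 1" using mult_pos_pos[OF \<alpha>(1) \<rho>] by simp
  have iff: "weak_subgradient (- \<rho>) f u ((1 / \<alpha>) *\<^sub>R (x - u)) \<longleftrightarrow> x = u + \<alpha> *\<^sub>R G u" for u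
  proof -
    have "(1 / \<alpha>) *\<^sub>R (x - u) = G u \<longleftrightarrow> \<alpha> *\<^sub>R ((1 / \<alpha>) *\<^sub>R (x - u)) = \<alpha> *\<^sub>R G u"
      using \<alpha>(1) by (subst scaleR_cancel_left) simp
    then show ?thesis
      using \<alpha>(1) by (simp add: f_subgradient_iff diff_eq_eq add.commute)
  qed
  have prox: "weak_subgradient (- \<rho>) f (prox \<alpha> f x) ((1 / \<alpha>) *\<^sub>R (x - prox \<alpha> f x))"
    using weak_subgradient_resolvent_exists[OF \<alpha>(1) neg f_convex' f_subgradient]
      prox_weak_subgradient[OF \<alpha>(1) less_imp_le[OF neg] f_convex'] by blast
  show ?thesis
    using prox weak_subgradient_resolvent_unique[OF \<alpha>(1) neg prox, of u] unfolding iff by metis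
qed

text \<open>Fermat's rule. Forwards, the upper model of \<open>f\<close> gives the constant
  \<sigma>, then sharpened to \<rho>; backwards, the quadratic terms -\<rho> of \<open>f\<close> and
  \<rho> of \<open>g\<close> cancel.\<close>

lemma minimizer_iff: "x \<in> minimizers (\<lambda>x. f x + g x) \<longleftrightarrow> weak_subgradient \<rho> g x (- G x)"
proof
  assume "x \<in> minimizers (\<lambda>x. f x + g x)"
  then have "f x + g x \<le> f y + g y" for y by (simp add: minimizers_def is_arg_min_linorder)
  then have "g x + - G x \<bullet> (y - x) - \<sigma> / 2 * (norm (y - x))\<^sup>2 \<le> g y" for y
    using f_upper[of y x] by (smt (verit) inner_minus_left)
  then show "weak_subgradient \<rho> g x (- G x)"
    using weak_subgradient_sharpen[OF g_convex] weak_subgradient_def by blast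
next
  assume x: "weak_subgradient \<rho> g x (- G x)"
  have "f x + g x \<le> f y + g y" for y
    using weak_subgradientD[OF x, of y] weak_subgradientD[OF f_subgradient, of x y] by simp
  then show "x \<in> minimizers (\<lambda>x. f x + g x)" by (simp add: minimizers_def is_arg_min_linorder)
qed

lemma prox_g_weak_subgradient:
  "weak_subgradient \<rho> g u ((1 / \<alpha>) *\<^sub>R (x - u)) \<Longrightarrow>
   weak_subgradient \<rho> g (prox \<alpha> g x) ((1 / \<alpha>) *\<^sub>R (x - prox \<alpha> g x))"
  using prox_weak_subgradient[OF \<alpha>(1) a_le_1 g_convex] by blast

section \<open>Lipschitz bounds for the reflected proximity operators\<close>

text \<open>With \<open>x - y = d + e\<close> and reflected difference \<open>d - e\<close>, the
  squared claim amounts to \<open>0 \<le> (e - a *\<^sub>R d) \<bullet> (d - a *\<^sub>R e)\<close>.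
  This is cocoercivity multiplied by \<open>a\<close>, with \<open>a * (\<alpha> * \<sigma>)\<close>
  raised to 1.\<close>

lemma reflected_f_lipschitz:
  "(1 + \<alpha> * \<rho>) * norm (reflected_prox \<alpha> f x - reflected_prox \<alpha> f y)
   \<le> (1 - \<alpha> * \<rho>) * norm (x - y)"
proof -
  define a where "a = \<alpha> * \<rho>"
  define u where "u = prox \<alpha> f x"
  define v where "v = prox \<alpha> f y"
  define d where "d = u - v"
  define e where "e = \<alpha> *\<^sub>R (G u - G v)"
  have x: "x = u + \<alpha> *\<^sub>R G u" and y: "y = v + \<alpha> *\<^sub>R G v"
    using prox_f_eq_iff u_def v_def by blast+
  have xy: "x - y = d + e" by (simp add: x y d_def e_def algebra_simps)
  have R: "reflected_prox \<alpha> f x - reflected_prox \<alpha> f y = d - e"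
    unfolding reflected_prox_def u_def[symmetric] v_def[symmetric]
    by (simp add: x y d_def e_def algebra_simps scaleR_2)
  have a: "0 < a" "a \<le> 1" using \<alpha> \<rho> a_le_1 by (auto simp: a_def)
  have "0 \<le> \<alpha>\<^sup>2 * ((G u - G v - \<rho> *\<^sub>R (u - v)) \<bullet> (\<sigma> *\<^sub>R (u - v) - (G u - G v)))"
    using gradient_cocoercive[OF f_subgradient f_upper, of u v] by simp
  also have "\<dots> = (e - a *\<^sub>R d) \<bullet> ((\<alpha> * \<sigma>) *\<^sub>R d - e)"
    by (simp add: e_def d_def a_def inner_diff_left inner_diff_right power2_eq_square algebra_simps)
  finally have "0 \<le> a * ((e - a *\<^sub>R d) \<bullet> ((\<alpha> * \<sigma>) *\<^sub>R d - e))" using a by simp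
  also have "\<dots> = a * (\<alpha> * \<sigma>) * ((e - a *\<^sub>R d) \<bullet> d) - a * ((e - a *\<^sub>R d) \<bullet> e)"
    by (simp add: inner_diff_right algebra_simps)
  \<comment> \<open>Raising the coefficient to 1 needs its factor to be nonnegative, which is strong
    monotonicity of the gradient.\<close>
  also have "\<dots> \<le> 1 * ((e - a *\<^sub>R d) \<bullet> d) - a * ((e - a *\<^sub>R d) \<bullet> e)"
  proof -
    have "\<rho> * (norm (u - v))\<^sup>2 \<le> (G u - G v) \<bullet> (u - v)"
      using weak_subgradient_monotone[OF f_subgradient f_subgradient, of u v] by simp
    then have "\<alpha> * (\<rho> * (norm (u - v))\<^sup>2) \<le> \<alpha> * ((G u - G v) \<bullet> (u - v))"
      using \<alpha> by simp
    then have "0 \<le> (e - a *\<^sub>R d) \<bullet> d"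
      by (simp add: a_def e_def d_def inner_diff_left power2_norm_eq_inner)
    then show ?thesis using a_mult_le_1 unfolding a_def[symmetric]
      by (intro diff_right_mono mult_right_mono)
  qed
  finally have "4 * a * (norm d)\<^sup>2 + 4 * a * (norm e)\<^sup>2 \<le> 4 * (1 + a\<^sup>2) * (d \<bullet> e)"
    unfolding power2_norm_eq_inner
    by (simp add: inner_diff_left inner_commute algebra_simps power2_eq_square)
  then have "((1 + a) * norm (d - e))\<^sup>2 \<le> ((1 - a) * norm (d + e))\<^sup>2"
    unfolding power_mult_distrib power2_norm_eq_inner
    by (simp add: inner_add_left inner_add_right inner_diff_left inner_diff_right inner_commute
        algebra_simps power2_eq_square)
  then show ?thesis
    unfolding R xy a_def[symmetric] by (rule power2_le_imp_le) (use a in simp)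
qed

text \<open>Weak monotonicity makes \<open>(1 - a) *\<^sub>R d\<close> behave like a firmly
  nonexpansive difference, so its reflection is no longer than \<open>e\<close>; the triangle
  inequality adds \<open>a *\<^sub>R e\<close>. For \<open>\<alpha> * \<rho> = 1\<close> the left
  side is 0.\<close>

lemma reflected_g_lipschitz:
  "(1 - \<alpha> * \<rho>) * norm (reflected_prox \<alpha> g x - reflected_prox \<alpha> g y)
   \<le> (1 + \<alpha> * \<rho>) * norm (x - y)"
proof (cases "\<alpha> * \<rho> = 1")
  case False
  define a where "a = \<alpha> * \<rho>"
  have a: "0 < a" "a < 1" using \<alpha> \<rho> a_le_1 False by (auto simp: a_def)
  \<comment> \<open>The minimizer supplies the one subgradient of \<open>g\<close> from which all
    resolvents exist.\<close>
  obtain x\<^sub>0 where "weak_subgradient \<rho> g x\<^sub>0 (- G x\<^sub>0)" using minimizer minimizer_iff by blast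
  then have prox: "weak_subgradient \<rho> g (prox \<alpha> g x) ((1 / \<alpha>) *\<^sub>R (x - prox \<alpha> g x))" for x
    using weak_subgradient_resolvent_exists[OF \<alpha>(1) _ g_convex] prox_g_weak_subgradient a a_def
    by blast
  define d where "d = prox \<alpha> g x - prox \<alpha> g y"
  define e where "e = x - y"
  have R: "reflected_prox \<alpha> g x - reflected_prox \<alpha> g y = 2 *\<^sub>R d - e"
    by (simp add: reflected_prox_def d_def e_def algebra_simps)
  have "(1 / \<alpha>) *\<^sub>R (x - prox \<alpha> g x) - (1 / \<alpha>) *\<^sub>R (y - prox \<alpha> g y) = (1 / \<alpha>) *\<^sub>R (e - d)"
    by (simp add: d_def e_def algebra_simps)
  then have "- \<rho> * (norm d)\<^sup>2 \<le> (1 / \<alpha>) * ((e - d) \<bullet> d)"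
    using weak_subgradient_monotone[OF prox prox, of x y] by (simp add: d_def)
  then have "\<alpha> * (- \<rho> * (norm d)\<^sup>2) \<le> \<alpha> * ((1 / \<alpha>) * ((e - d) \<bullet> d))"
    using \<alpha> by (intro mult_left_mono) auto
  then have "(1 - a) * (norm d)\<^sup>2 \<le> e \<bullet> d"
    using \<alpha> by (simp add: a_def inner_diff_left power2_norm_eq_inner algebra_simps)
  then have "4 * (1 - a) * ((1 - a) * (norm d)\<^sup>2) \<le> 4 * (1 - a) * (e \<bullet> d)"
    using a by (intro mult_left_mono) auto
  then have "(norm ((2 * (1 - a)) *\<^sub>R d - e))\<^sup>2 \<le> (norm e)\<^sup>2"
    unfolding power2_norm_eq_inner
    by (simp add: inner_diff_left inner_diff_right inner_commute algebra_simps)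
  then have "norm ((2 * (1 - a)) *\<^sub>R d - e) \<le> norm e" by (simp add: power2_le_iff_abs_le)
  moreover have "(1 - a) *\<^sub>R (2 *\<^sub>R d - e) = ((2 * (1 - a)) *\<^sub>R d - e) + a *\<^sub>R e"
    by (simp add: algebra_simps)
  then have "norm ((1 - a) *\<^sub>R (2 *\<^sub>R d - e)) \<le> norm ((2 * (1 - a)) *\<^sub>R d - e) + norm (a *\<^sub>R e)"
    by (metis norm_triangle_ineq)
  ultimately have "(1 - a) * norm (2 *\<^sub>R d - e) \<le> (1 + a) * norm e"
    using a by (simp add: distrib_right)
  then show ?thesis by (simp add: R a_def e_def)
qed simp

text \<open>The bounds chain through a multiple \<open>1 - \<alpha> * \<rho>\<close> that is never
  divided by, so \<open>\<alpha> * \<rho> = 1\<close> is included.\<close>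

lemma nonexpansive_fg:
  "norm ((reflected_prox \<alpha> f \<circ> reflected_prox \<alpha> g) x - (reflected_prox \<alpha> f \<circ> reflected_prox \<alpha> g) y)
   \<le> norm (x - y)" (is "?N \<le> _")
proof -
  have "(1 + \<alpha> * \<rho>) * ?N \<le> (1 + \<alpha> * \<rho>) * norm (x - y)"
    unfolding o_def by (rule order_trans[OF reflected_f_lipschitz reflected_g_lipschitz])
  moreover have "0 < 1 + \<alpha> * \<rho>" using \<alpha> \<rho> by (simp add: add_pos_pos)
  ultimately show ?thesis by simp
qed

lemma reflected_f_const:
  assumes "\<alpha> * \<rho> = 1"
  shows "reflected_prox \<alpha> f x = reflected_prox \<alpha> f y"
  using reflected_f_lipschitz[of x y] assms by simp

text \<open>Here \<open>1 - \<alpha> * \<rho>\<close> has to be cancelled; when it vanishes, the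
  inner reflection is constant.\<close>

lemma nonexpansive_gf:
  "norm ((reflected_prox \<alpha> g \<circ> reflected_prox \<alpha> f) x - (reflected_prox \<alpha> g \<circ> reflected_prox \<alpha> f) y)
   \<le> norm (x - y)" (is "?N \<le> _")
proof (cases "\<alpha> * \<rho> = 1")
  case True
  then show ?thesis using reflected_f_const[OF True, of x y] by simp
next
  case False
  have "(1 - \<alpha> * \<rho>) * ?N \<le> (1 - \<alpha> * \<rho>) * norm (x - y)"
    unfolding o_def by (rule order_trans[OF reflected_g_lipschitz reflected_f_lipschitz])
  then show ?thesis using a_le_1 False by simp
qed

section \<open>Fixed points and minimizers\<close>

lemma reflected_f_forward: "reflected_prox \<alpha> f (u + \<alpha> *\<^sub>R G u) = u - \<alpha> *\<^sub>R G u"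
  using prox_f_eq_iff[of "u + \<alpha> *\<^sub>R G u" u] by (simp add: reflected_prox_def scaleR_2)

lemma minimizer_iff_prox:
  "x \<in> minimizers (\<lambda>x. f x + g x)
   \<longleftrightarrow> weak_subgradient \<rho> g x ((1 / \<alpha>) *\<^sub>R ((x - \<alpha> *\<^sub>R G x) - x))"
  using \<alpha> by (simp add: minimizer_iff)

text \<open>If \<open>\<alpha>\<rho> = 1\<close>, the proximity operator of \<open>g\<close> may pick a point other than the given minimizer, hence
  the existential quantifier.\<close>

lemma forward_backward_fixed_point_exists:
  "\<exists>x. prox \<alpha> g (x - \<alpha> *\<^sub>R G x) = x"
proof -
  obtain x\<^sub>0 where x0: "x\<^sub>0 \<in> minimizers (\<lambda>x. f x + g x)" using minimizer by blast
  define z where "z = x\<^sub>0 - \<alpha> *\<^sub>R G x\<^sub>0"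
  define x where "x = prox \<alpha> g z"
  have sub0: "weak_subgradient \<rho> g x\<^sub>0 ((1 / \<alpha>) *\<^sub>R (z - x\<^sub>0))"
    using x0 unfolding z_def minimizer_iff_prox .
  then have sub: "weak_subgradient \<rho> g x ((1 / \<alpha>) *\<^sub>R (z - x))"
    unfolding x_def by (rule prox_g_weak_subgradient)
  \<comment> \<open>Replacing \<open>x\<^sub>0\<close> by the chosen point keeps the gradient step:
    either all gradient steps coincide, or the two points do.\<close>
  have "z = x - \<alpha> *\<^sub>R G x"
  proof (cases "\<alpha> * \<rho> = 1")
    case True
    then show ?thesis
      unfolding z_def reflected_f_forward[symmetric] by (rule reflected_f_const)
  next
    case False
    then have "x = x\<^sub>0"
      using weak_subgradient_resolvent_unique[OF \<alpha>(1) _ sub sub0] a_le_1 by simp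
    then show ?thesis by (simp add: z_def)
  qed
  then show ?thesis using x_def by metis
qed

text \<open>The reflections swap \<open>x - \<alpha> *\<^sub>R G x\<close> and
  \<open>x + \<alpha> *\<^sub>R G x\<close> when \<open>x\<close> is a forward-backward fixed
  point.\<close>

lemma fixed_point_fg_exists:
  "\<exists>z. (reflected_prox \<alpha> f \<circ> reflected_prox \<alpha> g) z = z"
proof -
  obtain x where x: "prox \<alpha> g (x - \<alpha> *\<^sub>R G x) = x" using forward_backward_fixed_point_exists by blast
  have "reflected_prox \<alpha> g (x - \<alpha> *\<^sub>R G x) = x + \<alpha> *\<^sub>R G x"
    unfolding reflected_prox_def x by (simp add: scaleR_2)
  then show ?thesis using reflected_f_forward[of x] by (metis o_apply)
qed

text \<open>The fixed point equation makes both proximal points equal to one \<open>x\<close>,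
  whence \<open>z = x - \<alpha> *\<^sub>R G x\<close>. The second conclusion serves the reversed
  composition.\<close>

lemma fixed_point_fg_minimizer:
  assumes z: "(reflected_prox \<alpha> f \<circ> reflected_prox \<alpha> g) z = z"
  shows "prox \<alpha> g z \<in> minimizers (\<lambda>x. f x + g x)"
    and "prox \<alpha> f (reflected_prox \<alpha> g z) = prox \<alpha> g z"
proof -
  define x where "x = prox \<alpha> g z"
  have "2 *\<^sub>R prox \<alpha> f (2 *\<^sub>R x - z) - (2 *\<^sub>R x - z) = z"
    using z by (simp add: reflected_prox_def x_def)
  then have "2 *\<^sub>R prox \<alpha> f (2 *\<^sub>R x - z) = 2 *\<^sub>R x"
    by (simp add: algebra_simps)
  then have f: "prox \<alpha> f (2 *\<^sub>R x - z) = x" by simp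
  then show "prox \<alpha> f (reflected_prox \<alpha> g z) = prox \<alpha> g z"
    by (simp add: reflected_prox_def x_def)
  have z_eq: "z = x - \<alpha> *\<^sub>R G x"
    using f prox_f_eq_iff[of "2 *\<^sub>R x - z" x] by (simp add: scaleR_2 algebra_simps)
  obtain x\<^sub>0 where x0: "x\<^sub>0 \<in> minimizers (\<lambda>x. f x + g x)" using minimizer by blast
  \<comment> \<open>This excludes that \<open>prox \<alpha> g z\<close> is an unspecified
    point.\<close>
  have "\<exists>u. weak_subgradient \<rho> g u ((1 / \<alpha>) *\<^sub>R (z - u))"
  proof (cases "\<alpha> * \<rho> = 1")
    case True
    then have "z = x\<^sub>0 - \<alpha> *\<^sub>R G x\<^sub>0"
      unfolding z_eq reflected_f_forward[symmetric] by (rule reflected_f_const)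
    then show ?thesis using x0 minimizer_iff_prox by metis
  next
    case False
    then show ?thesis
      using weak_subgradient_resolvent_exists[OF \<alpha>(1) _ g_convex] x0 minimizer_iff a_le_1 by force
  qed
  then have "weak_subgradient \<rho> g x ((1 / \<alpha>) *\<^sub>R (z - x))"
    unfolding x_def using prox_g_weak_subgradient by blast
  then show "prox \<alpha> g z \<in> minimizers (\<lambda>x. f x + g x)"
    unfolding x_def[symmetric] minimizer_iff_prox using z_eq by metis
qed

text \<open>\<open>reflected_prox \<alpha> g\<close> carries fixed points of one composition to
  fixed points of the other.\<close>

lemma fixed_point_gf_exists:
  "\<exists>w. (reflected_prox \<alpha> g \<circ> reflected_prox \<alpha> f) w = w"
  using fixed_point_fg_exists by (metis o_apply)

text \<open>The point \<open>reflected_prox \<alpha> f w\<close> is fixed by the other composition,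
  and its proximal point for \<open>g\<close> equals \<open>prox \<alpha> f w\<close>.\<close>

lemma fixed_point_gf_minimizer:
  assumes "(reflected_prox \<alpha> g \<circ> reflected_prox \<alpha> f) w = w"
  shows "prox \<alpha> f w \<in> minimizers (\<lambda>x. f x + g x)"
proof -
  have "(reflected_prox \<alpha> f \<circ> reflected_prox \<alpha> g) (reflected_prox \<alpha> f w) = reflected_prox \<alpha> f w"
    using assms by simp
  from fixed_point_fg_minimizer[OF this] show ?thesis using assms by simp
qed

end

theorem proposition2:
  fixes f g :: "real ^ 'n \<Rightarrow> real"
    and grad_f :: "real ^ 'n \<Rightarrow> real ^ 'n"
    and \<rho> \<sigma> \<alpha> lam :: real
  assumes "\<rho> > 0" and "\<sigma> > 0"
    and "weakly_convex \<rho> g"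
    and "convex_on UNIV (\<lambda>x. f x - \<rho> / 2 * (norm x)\<^sup>2)"
    and "\<And>x. GDERIV f x :> grad_f x"
    and "\<And>x. grad_f differentiable (at x)"
    and "\<And>x y. norm (grad_f x - grad_f y) \<le> \<sigma> * norm (x - y)"
    and "minimizers (\<lambda>x. f x + g x) \<noteq> {}"
    and "0 < \<alpha>" and "\<alpha> \<le> 1 / sqrt (\<sigma> * \<rho>)"
    and "0 < lam" and "lam < 1"
  shows "(\<forall>z :: nat \<Rightarrow> real ^ 'n.
           (\<forall>k. z (Suc k) = (1 - lam) *\<^sub>R z k
                  + lam *\<^sub>R (reflected_prox \<alpha> f \<circ> reflected_prox \<alpha> g) (z k)) \<longrightarrow>
           (\<exists>zs. z \<longlonglongrightarrow> zs \<and> prox \<alpha> g zs \<in> minimizers (\<lambda>x. f x + g x)))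
       \<and> (\<forall>z :: nat \<Rightarrow> real ^ 'n.
           (\<forall>k. z (Suc k) = (1 - lam) *\<^sub>R z k
                  + lam *\<^sub>R (reflected_prox \<alpha> g \<circ> reflected_prox \<alpha> f) (z k)) \<longrightarrow>
           (\<exists>zs. z \<longlonglongrightarrow> zs \<and> prox \<alpha> f zs \<in> minimizers (\<lambda>x. f x + g x)))"
proof -
  have "convex_on UNIV (\<lambda>x. g x + \<rho> / 2 * (norm x)\<^sup>2)"
    using assms(3) by (simp add: weakly_convex_def)
  then interpret douglas_rachford f g grad_f \<rho> \<sigma> \<alpha>
    using assms by unfold_locales auto
  show ?thesis
  proof (intro conjI allI impI)
    fix z :: "nat \<Rightarrow> real ^ 'n"
    assume z: "\<forall>k. z (Suc k) = (1 - lam) *\<^sub>R z k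
                  + lam *\<^sub>R (reflected_prox \<alpha> f \<circ> reflected_prox \<alpha> g) (z k)"
    obtain p where p: "(reflected_prox \<alpha> f \<circ> reflected_prox \<alpha> g) p = p"
      using fixed_point_fg_exists by blast
    obtain zs where "z \<longlonglongrightarrow> zs" "(reflected_prox \<alpha> f \<circ> reflected_prox \<alpha> g) zs = zs"
      using krasnoselskii_mann[where z = z, OF nonexpansive_fg p assms(11,12) z[rule_format]]
      by blast
    then show "\<exists>zs. z \<longlonglongrightarrow> zs \<and> prox \<alpha> g zs \<in> minimizers (\<lambda>x. f x + g x)"
      using fixed_point_fg_minimizer(1) by blast
  next
    fix z :: "nat \<Rightarrow> real ^ 'n"
    assume z: "\<forall>k. z (Suc k) = (1 - lam) *\<^sub>R z k
                  + lam *\<^sub>R (reflected_prox \<alpha> g \<circ> reflected_prox \<alpha> f) (z k)"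
    obtain p where p: "(reflected_prox \<alpha> g \<circ> reflected_prox \<alpha> f) p = p"
      using fixed_point_gf_exists by blast
    obtain zs where "z \<longlonglongrightarrow> zs" "(reflected_prox \<alpha> g \<circ> reflected_prox \<alpha> f) zs = zs"
      using krasnoselskii_mann[where z = z, OF nonexpansive_gf p assms(11,12) z[rule_format]]
      by blast
    then show "\<exists>zs. z \<longlonglongrightarrow> zs \<and> prox \<alpha> f zs \<in> minimizers (\<lambda>x. f x + g x)"
      using fixed_point_gf_minimizer by blast
  qed
qed

end
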